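(* Let $(\mathit{Init},\delta,\mathit{Bad})$ be a transition system over $n$ Boolean variables and let $k\in\mathbb{N}$. If there exists an inductive invariant $I$ that is forwards $k$-fenced and that is a CNF formula with $m$ clauses in which all variables appear only negatively, then the dual algorithm Dual-ITP-Inference-ClauseMin$(\mathit{Init},\delta,\mathit{Bad},k)$ converges to an inductive invariant using $O(m)$ inductiveness checks, $O(mn)$ $k$-BMC checks, and $O(mn)$ time.
   Context: Transition systems. $\Sigma=\{p_1,\dots,p_n\}$ is a finite set of Boolean variables; a state is a valuation of $\Sigma$; a formula over $\Sigma$ is identified with the set of states satisfying it, and $\varphi\Longrightarrow\psi$ means that $\varphi\to\psi$ is valid. A transition system is a triple $(\mathit{Init},\delta,\mathit{Bad})$ with $\mathit{Init},\mathit{Bad}$ formulas over $\Sigma$ and $\delta$ a formula over $\Sigma\uplus\Sigma'$ ($\Sigma'$ a primed copy), describing pairs (pre-state, post-state). Standing assumptions: $\mathit{Init}\not\equiv\mathit{false}$, $\mathit{Bad}\not\equiv\mathit{true},\mathit{false}$, $\mathit{Init}\Longrightarrow\neg\mathit{Bad}$. An inductive invariant is a formula $I$ over $\Sigma$ with (i) $\mathit{Init}\Longrightarrow I$, (ii) $I\wedge\delta\Longrightarrow I'$, (iii) $I\Longrightarrow\neg\mathit{Bad}$, where $I'$ is $I$ with variables primed. Bounded reachability. $\delta^{\le k}(S)$ is the set of states reachable from some state in $S$ by an execution of $\delta$ of at most $k$ steps. Fence condition. Two states are neighbors if they differ in exactly one variable. The inner boundary of $I$ is $\partial^+(I)=\{\sigma\models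 I : \sigma\text{ has a neighbor }\not\models I\}$. An inductive invariant $I$ is forwards $k$-fenced if $\partial^+(I)\subseteq\delta^{\le k}(\mathit{Init})$. A clause is a disjunction of literals; a CNF formula is a conjunction of clauses. A term is a conjunction of literals (also viewed as a set). $\mathrm{cube}(\sigma)$ is the conjunction of all literals true in $\sigma$. Algorithm ITP-Inference-TermMin$(\mathit{Init},\delta,\mathit{Bad},k)$: set $\varphi\leftarrow\mathit{Init}$. While $\varphi$ is not inductive: take any counterexample to induction $(\sigma,\sigma')\models\varphi\wedge\delta\wedge\neg\varphi'$; if $\delta^{\le k}(\{\sigma'\})\cap\mathit{Bad}\neq\emptyset$, the run with bound $k$ fails (restart with larger $k$); otherwise set $d\leftarrow\mathrm{cube}(\sigma')$ and, for each literal $\ell$ of $d$ in arbitrary order, if $\delta^{\le k}(d\setminus\{\ell\})\cap\mathit{Bad}=\emptyset$ set $d\leftarrow d\setminus\{\ell\}$; then set $\varphi\leftarrow\varphi\vee d$. When $\varphi$ is inductive, return $\varphi$. Dual algorithm. Dual-ITP-Inference-ClauseMin$(\mathit{Init},\delta,\mathit{Bad},k)$ is defined as $\neg\,$ITP-Inference-TermMin$(\mathit{Bad},\delta^{-1},\mathit{Init},k)$: run ITP-Inference-TermMin on the dual transition system $(\mathit{Bad},\delta^{-1},\mathit{Init})$, where $\delta^{-1}=\delta(\Sigma',\Sigma)$, and negate the result. "Converges to an inductive invariant" means that, for every resolution of the arbitrary choices, it terminates without failing with bound $k$ and returns an inductive invariant for $(\mathit{Init},\delta,\mathit{Bad})$.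 Complexity measure. An inductiveness check decides whether a candidate is an inductive invariant and returns a counterexample if not; a $k$-BMC check decides whether $\delta^{\le k}(\psi)\cap\mathit{Bad}=\emptyset$ or whether $\delta^{\le k}(\mathit{Init})\cap\psi=\emptyset$ for a given $\psi$. Time counts each such check (SAT oracle call) as one step. *)

theory Defs
  imports Main
begin

text \<open>
  The variables p_1, ..., p_n are represented by the indices 0, ..., n - 1, and a state is the list
  of their n truth values.  The number n is an explicit argument (rather than a type) so that the
  constants hidden in the O-bounds can be quantified before n.  A formula is identified with its
  set of models: a subset of \<open>states n\<close>, or of \<open>states n \<times> states n\<close> for a formula over the
  unprimed and primed variables.
\<close>

type_synonym state = "bool list"

definition states :: "nat \<Rightarrow> state set" where
  "states n = {s. length s = n}"

definition transition_system ::
  "nat \<Rightarrow> state set \<Rightarrow> (state \<times> state) set \<Rightarrow> state set \<Rightarrow> bool" where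
  "transition_system n Init \<delta> Bad \<longleftrightarrow>
     Init \<subseteq> states n \<and> \<delta> \<subseteq> states n \<times> states n \<and> Bad \<subseteq> states n \<and>
     Init \<noteq> {} \<and> Bad \<noteq> states n \<and> Bad \<noteq> {} \<and> Init \<subseteq> states n - Bad"

definition inductive_invariant ::
  "nat \<Rightarrow> state set \<Rightarrow> (state \<times> state) set \<Rightarrow> state set \<Rightarrow> state set \<Rightarrow> bool" where
  "inductive_invariant n Init \<delta> Bad I \<longleftrightarrow>
     I \<subseteq> states n \<and> Init \<subseteq> I \<and> \<delta> `` I \<subseteq> I \<and> I \<subseteq> states n - Bad"

definition bounded_reach :: "(state \<times> state) set \<Rightarrow> nat \<Rightarrow> state set \<Rightarrow> state set" where
  "bounded_reach \<delta> k S = (\<Union>i\<le>k. (\<delta> ^^ i) `` S)"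

definition neighbors :: "nat \<Rightarrow> state \<Rightarrow> state \<Rightarrow> bool" where
  "neighbors n s t \<longleftrightarrow> s \<in> states n \<and> t \<in> states n \<and> card {i. i < n \<and> s ! i \<noteq> t ! i} = 1"

definition inner_boundary :: "nat \<Rightarrow> state set \<Rightarrow> state set" where
  "inner_boundary n I = {s \<in> I. \<exists>t. neighbors n s t \<and> t \<notin> I}"

definition forwards_fenced ::
  "nat \<Rightarrow> state set \<Rightarrow> (state \<times> state) set \<Rightarrow> nat \<Rightarrow> state set \<Rightarrow> bool" where
  "forwards_fenced n Init \<delta> k I \<longleftrightarrow> inner_boundary n I \<subseteq> bounded_reach \<delta> k Init"

datatype literal = Pos (var: nat) | Neg (var: nat)

fun holds :: "state \<Rightarrow> literal \<Rightarrow> bool" where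
  "holds s (Pos i) \<longleftrightarrow> s ! i"
| "holds s (Neg i) \<longleftrightarrow> \<not> s ! i"

definition literals :: "nat \<Rightarrow> literal set" where
  "literals n = {l. var l < n}"

text \<open>
  Terms and clauses are sets of literals, read conjunctively and disjunctively respectively;
  a CNF formula is a set of clauses.
\<close>

definition term_models :: "nat \<Rightarrow> literal set \<Rightarrow> state set" where
  "term_models n d = {s \<in> states n. \<forall>l\<in>d. holds s l}"

definition cnf_formula :: "nat \<Rightarrow> literal set set \<Rightarrow> bool" where
  "cnf_formula n F \<longleftrightarrow> finite F \<and> (\<forall>c\<in>F. c \<subseteq> literals n)"

definition cnf_models :: "nat \<Rightarrow> literal set set \<Rightarrow> state set" where
  "cnf_models n F = {s \<in> states n. \<forall>c\<in>F. \<exists>l\<in>c. holds s l}"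

definition only_negative :: "literal set set \<Rightarrow> bool" where
  "only_negative F \<longleftrightarrow> (\<forall>c\<in>F. \<forall>l\<in>c. \<exists>i. l = Neg i)"

definition cube :: "nat \<Rightarrow> state \<Rightarrow> literal set" where
  "cube n s = {l \<in> literals n. holds s l}"

text \<open>
  ITP-Inference-TermMin is a labelled transition relation on control states; its nondeterminism
  is that of the choice of counterexamples and of the order in which literals are tried.
  A step is labelled with the oracle checks it performs.
  The control states are: the head of the main loop with the current candidate; the point at which
  the counterexample state has been obtained; the minimization loop with the current term d and the
  literals of the cube still to be tried; failure with bound k; and return of a candidate.

  The loop guard tests closure under \<open>\<delta>\<close> only.  Implication of the candidate by \<open>Init\<close> holds by
  construction, whereas its being disjoint from \<open>Bad\<close> is not tested by the algorithm.
\<close>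

datatype check = Inductiveness_Check | BMC_Check

datatype config =
    Loop "state set"
  | Counterexample "state set" state
  | Minimize "state set" "literal set" "literal set"
  | Failure
  | Return "state set"

inductive termmin_step ::
  "nat \<Rightarrow> (state \<times> state) set \<Rightarrow> state set \<Rightarrow> nat \<Rightarrow> config \<Rightarrow> check list \<Rightarrow> config \<Rightarrow> bool"
  for n \<delta> Bad k where
  finish:
    "\<delta> `` \<phi> \<subseteq> \<phi> \<Longrightarrow>
     termmin_step n \<delta> Bad k (Loop \<phi>) [Inductiveness_Check] (Return \<phi>)"
| counterexample:
    "\<sigma> \<in> \<phi> \<Longrightarrow> (\<sigma>, \<sigma>') \<in> \<delta> \<Longrightarrow> \<sigma>' \<notin> \<phi> \<Longrightarrow>
     termmin_step n \<delta> Bad k (Loop \<phi>) [Inductiveness_Check] (Counterexample \<phi> \<sigma>')"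
| fail:
    "bounded_reach \<delta> k {\<sigma>'} \<inter> Bad \<noteq> {} \<Longrightarrow>
     termmin_step n \<delta> Bad k (Counterexample \<phi> \<sigma>') [BMC_Check] Failure"
| start_minimize:
    "bounded_reach \<delta> k {\<sigma>'} \<inter> Bad = {} \<Longrightarrow>
     termmin_step n \<delta> Bad k (Counterexample \<phi> \<sigma>') [BMC_Check]
       (Minimize \<phi> (cube n \<sigma>') (cube n \<sigma>'))"
| drop_literal:
    "l \<in> L \<Longrightarrow> bounded_reach \<delta> k (term_models n (d - {l})) \<inter> Bad = {} \<Longrightarrow>
     termmin_step n \<delta> Bad k (Minimize \<phi> d L) [BMC_Check] (Minimize \<phi> (d - {l}) (L - {l}))"
| keep_literal:
    "l \<in> L \<Longrightarrow> bounded_reach \<delta> k (term_models n (d - {l})) \<inter> Bad \<noteq> {} \<Longrightarrow>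
     termmin_step n \<delta> Bad k (Minimize \<phi> d L) [BMC_Check] (Minimize \<phi> d (L - {l}))"
| add_term:
    "termmin_step n \<delta> Bad k (Minimize \<phi> d {}) [] (Loop (\<phi> \<union> term_models n d))"

text \<open>
  \<open>termmin_exec n Init \<delta> Bad k cs c\<close>: some, possibly partial, execution starting from
  the candidate \<open>Init\<close> performs the sequence of checks cs and ends in c.
\<close>

inductive termmin_exec ::
  "nat \<Rightarrow> state set \<Rightarrow> (state \<times> state) set \<Rightarrow> state set \<Rightarrow> nat \<Rightarrow> check list \<Rightarrow> config \<Rightarrow> bool"
  for n Init \<delta> Bad k where
  start: "termmin_exec n Init \<delta> Bad k [] (Loop Init)"
| step: "termmin_exec n Init \<delta> Bad k cs c \<Longrightarrow> termmin_step n \<delta> Bad k c cs' c' \<Longrightarrow>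
     termmin_exec n Init \<delta> Bad k (cs @ cs') c'"

definition termmin_terminates ::
  "nat \<Rightarrow> state set \<Rightarrow> (state \<times> state) set \<Rightarrow> state set \<Rightarrow> nat \<Rightarrow> bool" where
  "termmin_terminates n Init \<delta> Bad k \<longleftrightarrow>
     \<not> (\<exists>f. f 0 = Loop Init \<and> (\<forall>i. \<exists>cs. termmin_step n \<delta> Bad k (f i) cs (f (Suc i))))"

text \<open>
  The dual algorithm runs the above on the dual system \<open>(Bad, \<delta>\<inverse>, Init)\<close> and negates the result.
\<close>

definition dual_exec ::
  "nat \<Rightarrow> state set \<Rightarrow> (state \<times> state) set \<Rightarrow> state set \<Rightarrow> nat \<Rightarrow> check list \<Rightarrow> config \<Rightarrow> bool" where
  "dual_exec n Init \<delta> Bad k cs c \<longleftrightarrow> termmin_exec n Bad (\<delta>\<inverse>) Init k cs c"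

definition dual_converges ::
  "nat \<Rightarrow> state set \<Rightarrow> (state \<times> state) set \<Rightarrow> state set \<Rightarrow> nat \<Rightarrow> bool" where
  "dual_converges n Init \<delta> Bad k \<longleftrightarrow>
     termmin_terminates n Bad (\<delta>\<inverse>) Init k \<and>
     (\<forall>cs c. dual_exec n Init \<delta> Bad k cs c \<and>
             (\<nexists>cs' c'. termmin_step n (\<delta>\<inverse>) Init k c cs' c') \<longrightarrow>
        (\<exists>\<phi>. c = Return \<phi> \<and> inductive_invariant n Init \<delta> Bad (states n - \<phi>)))"

end

theory Submission imports Defs begin

text \<open>
  The negation of \<open>I\<close> is a monotone DNF with \<open>m\<close> terms, and it contains every candidate of the dual
  run.  By the fence condition, a bounded check on a term obtained by dropping one literal from an
  implicant of \<open>\<not> I\<close> decides whether the shorter term is still an implicant: otherwise the shorter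
  term has a model on the inner boundary of \<open>I\<close>.  Hence each minimization ends in a prime implicant
  of a monotone DNF, which is one of its \<open>m\<close> terms, and a new one each time, because it covers a
  counterexample outside the candidate.
\<close>

subsection \<open>Bounded reachability and terms\<close>

lemma relpow_Image_closed:
  fixes \<delta> :: "('a \<times> 'a) set"
  shows "\<delta> `` J \<subseteq> J \<Longrightarrow> S \<subseteq> J \<Longrightarrow> (\<delta> ^^ i) `` S \<subseteq> J"
  by (induction i) auto

lemma bounded_reach_closed: "\<delta> `` J \<subseteq> J \<Longrightarrow> S \<subseteq> J \<Longrightarrow> bounded_reach \<delta> k S \<subseteq> J"
  unfolding bounded_reach_def using relpow_Image_closed by blast

lemma bounded_reach_mono: "S \<subseteq> T \<Longrightarrow> bounded_reach \<delta> k S \<subseteq> bounded_reach \<delta> k T"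
  unfolding bounded_reach_def by blast

lemma relpow_converse:
  fixes \<delta> :: "('a \<times> 'a) set"
  shows "(\<delta>\<inverse>) ^^ i = (\<delta> ^^ i)\<inverse>"
proof (induction i)
  case (Suc i)
  have "(\<delta>\<inverse>) ^^ Suc i = \<delta>\<inverse> O (\<delta>\<inverse>) ^^ i" by (simp add: relpow_commute)
  then show ?case by (simp add: Suc converse_relcomp)
qed auto

text \<open>A dual check on a single state thereby asks whether that state is within
  \<open>k\<close> steps of the original \<open>Init\<close>, which is what the fence condition
  speaks of.\<close>

lemma bounded_reach_converse:
  "bounded_reach (\<delta>\<inverse>) k {s} \<inter> S \<noteq> {} \<longleftrightarrow> s \<in> bounded_reach \<delta> k S"
  unfolding bounded_reach_def relpow_converse by blast

section \<open>Terms and cubes\<close>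

lemma term_models_antimono: "d \<subseteq> e \<Longrightarrow> term_models n e \<subseteq> term_models n d"
  unfolding term_models_def by blast

lemma in_term_models_iff_cube:
  "d \<subseteq> literals n \<Longrightarrow> s \<in> states n \<Longrightarrow> s \<in> term_models n d \<longleftrightarrow> d \<subseteq> cube n s"
  unfolding term_models_def cube_def by blast

text \<open>Distinct literals over one variable contradict each other, so no state satisfies
  both.\<close>

lemma var_inj_on_cube: "inj_on var (cube n s)"
proof (rule inj_onI)
  fix x y assume "x \<in> cube n s" "y \<in> cube n s" "var x = var y"
  then show "x = y" by (cases x; cases y) (auto simp: cube_def)
qed

lemma var_cube_subset: "var ` cube n s \<subseteq> {..<n}"
  by (auto simp: cube_def literals_def)

lemma finite_cube: "finite (cube n s)"
  using var_inj_on_cube var_cube_subset by (metis finite_imageD finite_lessThan finite_subset)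

lemma card_cube_le: "card (cube n s) \<le> n"
  using card_mono[OF _ var_cube_subset] card_image[OF var_inj_on_cube] by fastforce

lemma holds_cong: "s ! var l = t ! var l \<Longrightarrow> holds s l \<longleftrightarrow> holds t l"
  by (cases l) auto

lemma term_models_cube:
  assumes "s \<in> states n" shows "term_models n (cube n s) = {s}"
proof -
  have "t = s" if t: "t \<in> term_models n (cube n s)" for t
  proof (rule nth_equalityI)
    show "length t = length s" using t assms by (auto simp: term_models_def states_def)
    fix i assume "i < length t"
    then have "i < n" using t by (auto simp: term_models_def states_def)
    then have "(if s ! i then Pos i else Neg i) \<in> cube n s"
      by (simp add: cube_def literals_def)
    then have "holds t (if s ! i then Pos i else Neg i)"
      using t unfolding term_models_def by blast
    then show "t ! i = s ! i" by (simp split: if_splits)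
  qed
  then show ?thesis using assms by (auto simp: term_models_def cube_def)
qed

text \<open>As part of a cube, \<open>d\<close> mentions the variable of \<open>l\<close> only once.
  Flipping it in \<open>s\<close> makes \<open>l\<close> true and leaves the other literals of
  \<open>d\<close> as they were.\<close>

lemma neighbor_dropped_literal:
  assumes "d \<subseteq> cube n \<sigma>" "l \<in> d" "s \<in> term_models n (d - {l})" "s \<notin> term_models n d"
  shows "\<exists>t \<in> term_models n d. neighbors n s t"
proof
  let ?t = "s[var l := \<not> s ! var l]"
  have len: "length s = n" and v: "var l < n"
    using assms by (auto simp: term_models_def states_def cube_def literals_def)
  have nl: "\<not> holds s l"
    using assms(3,4) by (auto simp: term_models_def)
  have "holds ?t l" using nl v len by (cases l) auto
  moreover have "holds ?t l'" if l': "l' \<in> d" "l' \<noteq> l" for l'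
  proof -
    have "var l' \<noteq> var l"
      using var_inj_on_cube assms(1,2) l' by (meson inj_onD subsetD)
    then have "holds ?t l' \<longleftrightarrow> holds s l'" by (intro holds_cong) simp
    then show ?thesis using assms(3) l' by (auto simp: term_models_def)
  qed
  ultimately show "?t \<in> term_models n d"
    using len by (auto simp: term_models_def states_def)
  have "{i. i < n \<and> s ! i \<noteq> ?t ! i} = {var l}"
    using v len by (auto simp: nth_list_update)
  then show "neighbors n s ?t"
    using len by (simp add: neighbors_def states_def)
qed

subsection \<open>Term minimization below a fenced monotone DNF\<close>

lemma count_list_checks:
  "length cs = count_list cs Inductiveness_Check + count_list cs BMC_Check"
proof (induction cs)
  case (Cons c cs)
  then show ?case by (cases c) auto
qed simp

fun is_Loop :: "config \<Rightarrow> bool" where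
  "is_Loop (Loop \<phi>) \<longleftrightarrow> True"
| "is_Loop c \<longleftrightarrow> False"

text \<open>Only \<open>add_term\<close> is free of checks, and it ends in a \<open>Loop\<close>
  state, from which every step performs one. Free steps are thus never consecutive; the
  \<open>of_bool\<close> term pays for one just made.\<close>

lemma infinite_run_many_checks:
  assumes "f 0 = Loop Init" and "\<forall>i. \<exists>cs. termmin_step n \<delta> Bad k (f i) cs (f (Suc i))"
  shows "\<exists>cs. termmin_exec n Init \<delta> Bad k cs (f i) \<and> i \<le> 2 * length cs + of_bool (is_Loop (f i))"
proof (induction i)
  case 0
  then show ?case using assms(1) termmin_exec.start by fastforce
next
  case (Suc i)
  then obtain cs where cs: "termmin_exec n Init \<delta> Bad k cs (f i)"
    "i \<le> 2 * length cs + of_bool (is_Loop (f i))" by blast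
  from assms(2) obtain cs' where st: "termmin_step n \<delta> Bad k (f i) cs' (f (Suc i))" by blast
  from st have "of_bool (is_Loop (f i)) + 1
      \<le> 2 * length cs' + (of_bool (is_Loop (f (Suc i))) :: nat)"
    by cases auto
  then show ?case using termmin_exec.step[OF cs(1) st] cs(2)
    by (intro exI[of _ "cs @ cs'"]) auto
qed

text \<open>The setting of one run, to be instantiated with the dual system and with the complement
  of the invariant as \<open>J\<close>; \<open>fence\<close> is the dual reading of the inner
  boundary condition.\<close>

locale fenced_monotone_dnf =
  fixes n k :: nat and Init Bad :: "state set" and \<delta> :: "(state \<times> state) set"
    and T :: "literal set set" and J :: "state set"
  assumes J_def: "J = (\<Union>t\<in>T. term_models n t)"
    and finite_T: "finite T"
    and T_literals: "t \<in> T \<Longrightarrow> t \<subseteq> literals n"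
    and T_positive: "t \<in> T \<Longrightarrow> l \<in> t \<Longrightarrow> \<exists>i. l = Pos i"
    and Init_J: "Init \<subseteq> J"
    and closed_J: "\<delta> `` J \<subseteq> J"
    and J_Bad: "J \<inter> Bad = {}"
    and fence: "neighbors n s s' \<Longrightarrow> s \<notin> J \<Longrightarrow> s' \<in> J \<Longrightarrow> bounded_reach \<delta> k {s} \<inter> Bad \<noteq> {}"
begin

section \<open>Implicants and the fence condition\<close>

lemma J_states: "J \<subseteq> states n"
  by (auto simp: J_def term_models_def)

lemma bounded_reach_J: "S \<subseteq> J \<Longrightarrow> bounded_reach \<delta> k S \<inter> Bad = {}"
  using bounded_reach_closed[OF closed_J] J_Bad by blast

text \<open>A model of the shorter term outside \<open>J\<close> has a neighbor among the models of
  \<open>d\<close>, which lie in \<open>J\<close>, so \<open>fence\<close> refutes the check.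
  Conversely, \<open>J\<close> is closed and avoids \<open>Bad\<close>.\<close>

lemma implicant_drop_iff:
  assumes "d \<subseteq> cube n \<sigma>" "l \<in> d" "term_models n d \<subseteq> J"
  shows "bounded_reach \<delta> k (term_models n (d - {l})) \<inter> Bad = {} \<longleftrightarrow> term_models n (d - {l}) \<subseteq> J"
proof
  assume safe: "bounded_reach \<delta> k (term_models n (d - {l})) \<inter> Bad = {}"
  show "term_models n (d - {l}) \<subseteq> J"
  proof
    fix s assume s: "s \<in> term_models n (d - {l})"
    then have "bounded_reach \<delta> k {s} \<inter> Bad = {}"
      using safe bounded_reach_mono[of "{s}"] by blast
    then show "s \<in> J"
      using neighbor_dropped_literal[OF assms(1,2) s] fence assms(3) by blast
  qed
qed (rule bounded_reach_J)

text \<open>The least model of \<open>d\<close> satisfies a term of the DNF, and that term consists of literals of \<open>d\<close>.\<close>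

lemma implicant_contains_term:
  assumes "d \<subseteq> cube n \<sigma>" "term_models n d \<subseteq> J"
  shows "\<exists>t\<in>T. t \<subseteq> d"
proof -
  let ?s = "map (\<lambda>i. Pos i \<in> d) [0..<n]"
  have "holds ?s l" if "l \<in> d" for l
  proof (cases l)
    case (Pos i)
    then show ?thesis using that assms(1) by (auto simp: cube_def literals_def)
  next
    case (Neg i)
    then have "Neg i \<in> cube n \<sigma>" using that assms(1) by blast
    then have "Pos i \<notin> d" "i < n" using assms(1) by (auto simp: cube_def literals_def)
    then show ?thesis using Neg by simp
  qed
  then have "?s \<in> J" using assms(2) by (auto simp: term_models_def states_def)
  then obtain t where t: "t \<in> T" "?s \<in> term_models n t" by (auto simp: J_def)
  have "l \<in> d" if l: "l \<in> t" for l
  proof -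
    obtain i where "l = Pos i" using T_positive[OF t(1) l] by blast
    moreover have "holds ?s l" "var l < n"
      using t l T_literals by (auto simp: term_models_def literals_def)
    ultimately show ?thesis by simp
  qed
  then show ?thesis using t(1) by blast
qed

text \<open>A literal of \<open>d\<close> outside the term \<open>t\<close> contained in
  \<open>d\<close> could be dropped without leaving \<open>J\<close>, so \<open>d\<close> equals
  \<open>t\<close>.\<close>

lemma prime_implicant_in_T:
  assumes "d \<subseteq> cube n \<sigma>" "term_models n d \<subseteq> J" "\<forall>l\<in>d. \<not> term_models n (d - {l}) \<subseteq> J"
  shows "d \<in> T"
proof -
  obtain t where t: "t \<in> T" "t \<subseteq> d" using implicant_contains_term assms(1,2) by blast
  have "l \<in> t" if "l \<in> d" for l
  proof (rule ccontr)
    assume "l \<notin> t"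
    then have "term_models n (d - {l}) \<subseteq> term_models n t"
      using t(2) by (intro term_models_antimono) blast
    then show False using assms(3) that t(1) by (auto simp: J_def)
  qed
  then show ?thesis using t by (metis subsetI subset_antisym)
qed

section \<open>The invariant of a run\<close>

definition candidate :: "literal set set \<Rightarrow> state set" where
  "candidate P = Init \<union> (\<Union>t\<in>P. term_models n t)"

lemma candidate_J: "P \<subseteq> T \<Longrightarrow> candidate P \<subseteq> J"
  using Init_J by (auto simp: candidate_def J_def)

text \<open>\<open>P\<close> collects the terms added so far; \<open>a\<close> and \<open>b\<close>
  count inductiveness and BMC checks. A round costs one inductiveness check and at most
  \<open>n + 1\<close> BMC checks: one on the counterexample and one per literal of its cube. During
  minimization the untried literals \<open>L\<close> are charged in advance, and those in
  \<open>d - L\<close> are known to be indispensable.\<close>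

fun run_invariant :: "literal set set \<Rightarrow> nat \<Rightarrow> nat \<Rightarrow> config \<Rightarrow> bool" where
  "run_invariant P a b (Loop \<phi>) \<longleftrightarrow>
     \<phi> = candidate P \<and> a = card P \<and> b \<le> card P * (n + 1)"
| "run_invariant P a b (Counterexample \<phi> \<sigma>) \<longleftrightarrow>
     \<phi> = candidate P \<and> \<sigma> \<in> J - \<phi> \<and> a = card P + 1 \<and> card P < card T \<and> b \<le> card P * (n + 1)"
| "run_invariant P a b (Minimize \<phi> d L) \<longleftrightarrow>
     \<phi> = candidate P \<and> a = card P + 1 \<and> card P < card T \<and>
     b + card L \<le> (card P + 1) * (n + 1) \<and>
     (\<exists>\<sigma> \<in> J - \<phi>. L \<subseteq> d \<and> d \<subseteq> cube n \<sigma> \<and> term_models n d \<subseteq> J \<and>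
        (\<forall>l\<in>d - L. \<not> term_models n (d - {l}) \<subseteq> J))"
| "run_invariant P a b Failure \<longleftrightarrow> False"
| "run_invariant P a b (Return \<phi>) \<longleftrightarrow>
     \<phi> = candidate P \<and> \<delta> `` \<phi> \<subseteq> \<phi> \<and> a = card P + 1 \<and> b \<le> card P * (n + 1)"

lemma run_invariant_Minimize_I:
  assumes "\<phi> = candidate P" "a = card P + 1" "card P < card T"
    and "b + card L \<le> (card P + 1) * (n + 1)"
    and "\<sigma> \<in> J - \<phi>" "L \<subseteq> d" "d \<subseteq> cube n \<sigma>" "term_models n d \<subseteq> J"
    and "\<And>l. l \<in> d - L \<Longrightarrow> \<not> term_models n (d - {l}) \<subseteq> J"
  shows "run_invariant P a b (Minimize \<phi> d L)"
  using assms unfolding run_invariant.simps by blast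

text \<open>With all of \<open>T\<close> added, the candidate would cover \<open>J\<close>.\<close>

lemma card_uncovered:
  assumes "P \<subseteq> T" "\<sigma> \<in> J - candidate P" shows "card P < card T"
proof -
  have "P \<noteq> T" using assms(2) by (auto simp: candidate_def J_def)
  then show ?thesis using assms(1) finite_T by (meson psubset_card_mono psubsetI)
qed

text \<open>The set \<open>P\<close> changes only in \<open>add_term\<close>, which inserts one new
  term.\<close>

lemma exec_invariant:
  assumes "termmin_exec n Init \<delta> Bad k cs c"
  shows "\<exists>P\<subseteq>T. run_invariant P (count_list cs Inductiveness_Check) (count_list cs BMC_Check) c"
  using assms
proof induction
  case start
  then show ?case by (intro exI[of _ "{}"]) (simp add: candidate_def)
next
  case (step cs c cs' c')
  then obtain P where P: "P \<subseteq> T" and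
    inv: "run_invariant P (count_list cs Inductiveness_Check) (count_list cs BMC_Check) c" by blast
  from step.hyps(2) show ?case
  proof cases
    case (finish \<phi>)
    then show ?thesis using P inv by (intro exI[of _ P]) auto
  next
    case (counterexample \<sigma> \<phi> \<sigma>')
    \<comment> \<open>A step from the candidate cannot leave the closed set \<open>J\<close>; this
      is what later rules out \<open>fail\<close>.\<close>
    then have "\<sigma>' \<in> J - candidate P"
      using P inv candidate_J[OF P] closed_J by auto
    then show ?thesis using counterexample P inv card_uncovered[OF P]
      by (intro exI[of _ P]) auto
  next
    case (fail \<sigma>' \<phi>)
    then show ?thesis using inv bounded_reach_J[of "{\<sigma>'}"] by auto
  next
    case (start_minimize \<sigma>' \<phi>)
    have inv': "run_invariant P (count_list cs Inductiveness_Check) (count_list cs BMC_Check)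
        (Counterexample \<phi> \<sigma>')" using inv unfolding start_minimize(1) .
    then have \<sigma>': "\<sigma>' \<in> J - \<phi>" by auto
    then have "\<sigma>' \<in> states n" using J_states by blast
    then have "term_models n (cube n \<sigma>') \<subseteq> J"
      using \<sigma>' by (simp add: term_models_cube)
    \<comment> \<open>Of the \<open>n + 1\<close> BMC checks of the round, one has been made and at
      most \<open>n\<close> await the cube.\<close>
    then have "run_invariant P (count_list (cs @ cs') Inductiveness_Check)
        (count_list (cs @ cs') BMC_Check) c'"
      unfolding start_minimize(2,3)
      using inv' \<sigma>' card_cube_le[of n \<sigma>'] by (intro run_invariant_Minimize_I[of _ _ _ _ _ \<sigma>']) auto
    then show ?thesis using P by blast
  next
    case (drop_literal l L d \<phi>)
    have "run_invariant P (count_list cs Inductiveness_Check) (count_list cs BMC_Check)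
        (Minimize \<phi> d L)" using inv unfolding drop_literal(1) .
    then obtain \<sigma> where base: "\<phi> = candidate P" "count_list cs Inductiveness_Check = card P + 1"
      "card P < card T" "count_list cs BMC_Check + card L \<le> (card P + 1) * (n + 1)"
      and \<sigma>: "\<sigma> \<in> J - \<phi>" "L \<subseteq> d" "d \<subseteq> cube n \<sigma>" "term_models n d \<subseteq> J"
      "\<forall>l\<in>d - L. \<not> term_models n (d - {l}) \<subseteq> J" unfolding run_invariant.simps by blast
    have "finite L" using \<sigma> finite_cube finite_subset by metis
    then have L: "card L = Suc (card (L - {l}))" using drop_literal(4) by (metis card_Suc_Diff1)
    have new1: "term_models n (d - {l}) \<subseteq> J"
      using implicant_drop_iff[of d \<sigma> l] drop_literal(4,5) \<sigma> by blast
    \<comment> \<open>Shortening the term only adds models, so a literal kept earlier stays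
      indispensable.\<close>
    have new2: "\<not> term_models n (d - {l} - {l'}) \<subseteq> J" if "l' \<in> d - {l} - (L - {l})" for l'
      using \<sigma>(5) that term_models_antimono[of "d - {l} - {l'}" "d - {l'}" n] by blast
    note new = new1 new2
    have "run_invariant P (count_list (cs @ cs') Inductiveness_Check)
        (count_list (cs @ cs') BMC_Check) c'"
      unfolding drop_literal(2,3)
    proof (rule run_invariant_Minimize_I[OF base(1) _ base(3) _ \<sigma>(1)])
      show "count_list (cs @ [BMC_Check]) Inductiveness_Check = card P + 1"
        using base(2) by simp
      show "count_list (cs @ [BMC_Check]) BMC_Check + card (L - {l}) \<le> (card P + 1) * (n + 1)"
        using base(4) L by simp
    qed (use \<sigma> new in blast)+
    then show ?thesis using P by blast
  next
    case (keep_literal l L d \<phi>)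
    have "run_invariant P (count_list cs Inductiveness_Check) (count_list cs BMC_Check)
        (Minimize \<phi> d L)" using inv unfolding keep_literal(1) .
    then obtain \<sigma> where base: "\<phi> = candidate P" "count_list cs Inductiveness_Check = card P + 1"
      "card P < card T" "count_list cs BMC_Check + card L \<le> (card P + 1) * (n + 1)"
      and \<sigma>: "\<sigma> \<in> J - \<phi>" "L \<subseteq> d" "d \<subseteq> cube n \<sigma>" "term_models n d \<subseteq> J"
      "\<forall>l\<in>d - L. \<not> term_models n (d - {l}) \<subseteq> J" unfolding run_invariant.simps by blast
    have "finite L" using \<sigma> finite_cube finite_subset by metis
    then have L: "card L = Suc (card (L - {l}))" using keep_literal(4) by (metis card_Suc_Diff1)
    \<comment> \<open>Sets inside \<open>J\<close> pass the check, so a failed check shows that the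
      shorter term leaves \<open>J\<close>.\<close>
    have new: "\<not> term_models n (d - {l}) \<subseteq> J" using bounded_reach_J keep_literal(5) by blast
    have "run_invariant P (count_list (cs @ cs') Inductiveness_Check)
        (count_list (cs @ cs') BMC_Check) c'"
      unfolding keep_literal(2,3)
    proof (rule run_invariant_Minimize_I[OF base(1) _ base(3) _ \<sigma>(1)])
      show "count_list (cs @ [BMC_Check]) Inductiveness_Check = card P + 1"
        using base(2) by simp
      show "count_list (cs @ [BMC_Check]) BMC_Check + card (L - {l}) \<le> (card P + 1) * (n + 1)"
        using base(4) L by simp
    qed (use \<sigma> new in blast)+
    then show ?thesis using P by blast
  next
    case (add_term \<phi> d)
    have inv': "run_invariant P (count_list cs Inductiveness_Check) (count_list cs BMC_Check)
        (Minimize \<phi> d {})" using inv unfolding add_term(1) .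
    then obtain \<sigma> where \<sigma>: "\<sigma> \<in> J - \<phi>" "d \<subseteq> cube n \<sigma>" "term_models n d \<subseteq> J"
      "\<forall>l\<in>d. \<not> term_models n (d - {l}) \<subseteq> J"
      unfolding run_invariant.simps Diff_empty by blast
    \<comment> \<open>With no literal left to try, every literal of \<open>d\<close> is
      indispensable.\<close>
    then have d: "d \<in> T" using prime_implicant_in_T by blast
    have "\<sigma> \<in> term_models n d"
      using \<sigma> J_states T_literals[OF d] in_term_models_iff_cube by blast
    then have "d \<notin> P" using \<sigma>(1) inv' by (auto simp: candidate_def)
    then have "card (insert d P) = card P + 1"
      using P finite_T by (simp add: finite_subset)
    moreover have "candidate (insert d P) = candidate P \<union> term_models n d"
      by (auto simp: candidate_def)
    ultimately show ?thesis using d P inv' add_term(2,3)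
      by (intro exI[of _ "insert d P"]) auto
  qed
qed

lemma exec_checks:
  assumes "termmin_exec n Init \<delta> Bad k cs c"
  shows "count_list cs Inductiveness_Check \<le> card T + 1"
    and "count_list cs BMC_Check \<le> card T * (n + 1)"
proof -
  obtain P where P: "P \<subseteq> T" and
    inv: "run_invariant P (count_list cs Inductiveness_Check) (count_list cs BMC_Check) c"
    using exec_invariant[OF assms] by blast
  have le: "card P \<le> card T" using P finite_T by (rule card_mono[rotated])
  \<comment> \<open>The additional check is the last one, which finds the candidate closed.\<close>
  show "count_list cs Inductiveness_Check \<le> card T + 1"
    using inv le by (cases c) auto
  \<comment> \<open>The second alternative is a run inside a minimization: its term is not yet in
    \<open>P\<close>, but there is room for it in \<open>T\<close>.\<close>
  have "count_list cs BMC_Check \<le> card P * (n + 1) \<or>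
      card P + 1 \<le> card T \<and> count_list cs BMC_Check \<le> (card P + 1) * (n + 1)"
    using inv by (cases c) auto
  then show "count_list cs BMC_Check \<le> card T * (n + 1)"
    using mult_le_mono1[OF le, of "n + 1"] mult_le_mono1[of "card P + 1" "card T" "n + 1"]
    by (meson le_trans)
qed

lemma terminates: "termmin_terminates n Init \<delta> Bad k"
  unfolding termmin_terminates_def
proof
  let ?B = "card T + 1 + card T * (n + 1)"
  assume "\<exists>f. f 0 = Loop Init \<and> (\<forall>i. \<exists>cs. termmin_step n \<delta> Bad k (f i) cs (f (Suc i)))"
  then obtain f where "f 0 = Loop Init"
    "\<forall>i. \<exists>cs. termmin_step n \<delta> Bad k (f i) cs (f (Suc i))" by blast
  \<comment> \<open>At most \<open>2 * ?B + 1\<close> steps are possible with \<open>?B\<close>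
    checks.\<close>
  from infinite_run_many_checks[OF this, of "2 * ?B + 2"] obtain cs where
    cs: "termmin_exec n Init \<delta> Bad k cs (f (2 * ?B + 2))"
    "2 * ?B + 2 \<le> 2 * length cs + of_bool (is_Loop (f (2 * ?B + 2)))" by blast
  then have "?B < length cs" by (auto simp: of_bool_def split: if_splits)
  then show False using exec_checks[OF cs(1)] count_list_checks[of cs] by linarith
qed

text \<open>The guards at each control point are exhaustive, and the invariant excludes
  \<open>Failure\<close>. Containment in \<open>J\<close> supplies the disjointness from
  \<open>Bad\<close> that the algorithm does not test.\<close>

lemma stuck_returns:
  assumes "termmin_exec n Init \<delta> Bad k cs c" and "\<nexists>cs' c'. termmin_step n \<delta> Bad k c cs' c'"
  shows "\<exists>\<phi>. c = Return \<phi> \<and> Init \<subseteq> \<phi> \<and> \<delta> `` \<phi> \<subseteq> \<phi> \<and> \<phi> \<subseteq> J"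
proof -
  obtain P where P: "P \<subseteq> T" and
    inv: "run_invariant P (count_list cs Inductiveness_Check) (count_list cs BMC_Check) c"
    using exec_invariant[OF assms(1)] by blast
  show ?thesis
  proof (cases c)
    case (Loop \<phi>)
    then show ?thesis
      using assms(2) termmin_step.finish[of \<delta> \<phi>] termmin_step.counterexample[of _ \<phi>] by blast
  next
    case (Counterexample \<phi> \<sigma>)
    then show ?thesis
      using assms(2) termmin_step.fail[of \<delta> k \<sigma> Bad n \<phi>]
        termmin_step.start_minimize[of \<delta> k \<sigma> Bad n \<phi>] by blast
  next
    case (Minimize \<phi> d L)
    show ?thesis
    proof (cases "L = {}")
      case True
      then show ?thesis using assms(2) Minimize termmin_step.add_term[of n \<delta> Bad k \<phi> d] by blast
    next
      case False
      then obtain l where "l \<in> L" by blast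
      then show ?thesis
        using assms(2) Minimize termmin_step.drop_literal[of l L \<delta> k n d Bad \<phi>]
          termmin_step.keep_literal[of l L \<delta> k n d Bad \<phi>] by blast
    qed
  next
    case Failure
    then show ?thesis using inv by simp
  next
    case (Return \<phi>)
    then have "\<phi> = candidate P" "\<delta> `` \<phi> \<subseteq> \<phi>" using inv by auto
    then show ?thesis using Return candidate_J[OF P] by (simp add: candidate_def)
  qed
qed

end

subsection \<open>The dual run\<close>

text \<open>On clauses with negative literals only, \<open>Pos \<circ> var\<close> is the complementation of literals.\<close>

lemma complement_negative_cnf:
  assumes "only_negative F"
  shows "states n - cnf_models n F = (\<Union>t\<in>(\<lambda>c. (Pos \<circ> var) ` c) ` F. term_models n t)"
proof -
  have "holds s (Pos (var l)) \<longleftrightarrow> \<not> holds s l" if "c \<in> F" "l \<in> c" for s c l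
    using assms that by (force simp: only_negative_def)
  then show ?thesis by (auto simp: cnf_models_def term_models_def)
qed

lemma dual_fenced_monotone_dnf:
  assumes "transition_system n Init \<delta> Bad" and "inductive_invariant n Init \<delta> Bad I"
    and "forwards_fenced n Init \<delta> k I"
    and "cnf_formula n F" and "only_negative F" and "I = cnf_models n F"
  shows "fenced_monotone_dnf n k Bad Init (\<delta>\<inverse>) ((\<lambda>c. (Pos \<circ> var) ` c) ` F) (states n - I)"
proof
  show "states n - I = (\<Union>t\<in>(\<lambda>c. (Pos \<circ> var) ` c) ` F. term_models n t)"
    using complement_negative_cnf assms(5,6) by blast
  show "finite ((\<lambda>c. (Pos \<circ> var) ` c) ` F)" using assms(4) by (simp add: cnf_formula_def)
  show "t \<subseteq> literals n" if "t \<in> (\<lambda>c. (Pos \<circ> var) ` c) ` F" for t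
    using assms(4) that by (fastforce simp: cnf_formula_def literals_def)
  show "\<exists>i. l = Pos i" if "t \<in> (\<lambda>c. (Pos \<circ> var) ` c) ` F" "l \<in> t" for t l
    using that by auto
  \<comment> \<open>The complement of a set closed under \<open>\<delta>\<close> is closed under
    \<open>\<delta>\<inverse>\<close>.\<close>
  show "Bad \<subseteq> states n - I" "\<delta>\<inverse> `` (states n - I) \<subseteq> states n - I" "(states n - I) \<inter> Init = {}"
    using assms(1,2) by (auto simp: transition_system_def inductive_invariant_def)
  \<comment> \<open>Such an \<open>s\<close> lies on the inner boundary of \<open>I\<close>.\<close>
  show "bounded_reach (\<delta>\<inverse>) k {s} \<inter> Init \<noteq> {}"
    if "neighbors n s t" "s \<notin> states n - I" "t \<in> states n - I" for s t
    using that assms(3) unfolding bounded_reach_converse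
    by (auto simp: forwards_fenced_def inner_boundary_def neighbors_def)
qed

text \<open>\<open>n = 0\<close> and \<open>m = 0\<close> have to be excluded for \<open>O(m)\<close> and \<open>O(mn)\<close> to absorb additive constants.\<close>

lemma transition_system_pos:
  assumes "transition_system n Init \<delta> Bad" shows "n \<ge> 1"
proof (rule ccontr)
  assume "\<not> n \<ge> 1"
  then have "n = 0" by simp
  then have "states n = {[]}" by (auto simp: states_def)
  then show False using assms by (auto simp: transition_system_def)
qed

text \<open>The empty CNF is true everywhere, whereas an invariant excludes the nonempty
  \<open>Bad\<close>.\<close>

lemma cnf_invariant_card_pos:
  assumes "transition_system n Init \<delta> Bad" and "inductive_invariant n Init \<delta> Bad (cnf_models n F)"
    and "cnf_formula n F"
  shows "card F \<ge> 1"
proof (rule ccontr)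
  assume "\<not> card F \<ge> 1"
  then have "card F = 0" by simp
  then have "F = {}" using assms(3) by (simp add: cnf_formula_def)
  then show False using assms(1,2)
    by (auto simp: transition_system_def inductive_invariant_def cnf_models_def)
qed

theorem corollary5p9:
  "\<exists>C::nat. \<forall>n m k Init \<delta> Bad I F.
     transition_system n Init \<delta> Bad \<longrightarrow>
     inductive_invariant n Init \<delta> Bad I \<longrightarrow>
     forwards_fenced n Init \<delta> k I \<longrightarrow>
     cnf_formula n F \<longrightarrow> card F = m \<longrightarrow> only_negative F \<longrightarrow> I = cnf_models n F \<longrightarrow>
       dual_converges n Init \<delta> Bad k \<and>
       (\<forall>cs c. dual_exec n Init \<delta> Bad k cs c \<longrightarrow>
          count_list cs Inductiveness_Check \<le> C * m \<and>
          count_list cs BMC_Check \<le> C * (m * n) \<and>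
          length cs \<le> C * (m * n))"
proof (intro exI[of _ 4] allI impI)
  fix n m k :: nat and Init \<delta> Bad I and F :: "literal set set"
  assume ts: "transition_system n Init \<delta> Bad" and inv: "inductive_invariant n Init \<delta> Bad I"
    and fenced: "forwards_fenced n Init \<delta> k I" and cnf: "cnf_formula n F" "card F = m"
    "only_negative F" and I: "I = cnf_models n F"
  let ?T = "(\<lambda>c. (Pos \<circ> var) ` c) ` F"
  interpret fenced_monotone_dnf n k Bad Init "\<delta>\<inverse>" ?T "states n - I"
    using dual_fenced_monotone_dnf[OF ts inv fenced cnf(1,3) I] .
  have T: "card ?T \<le> m"
    using cnf(1,2) card_image_le[of F "\<lambda>c. (Pos \<circ> var) ` c"] unfolding cnf_formula_def by blast
  have m: "m \<ge> 1" using cnf_invariant_card_pos[OF ts inv[unfolded I] cnf(1)] cnf(2) by simp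
  have mn: "m \<le> m * n" using transition_system_pos[OF ts] by simp
  have "\<exists>\<phi>. c = Return \<phi> \<and> inductive_invariant n Init \<delta> Bad (states n - \<phi>)"
    if ex: "dual_exec n Init \<delta> Bad k cs c" "\<nexists>cs' c'. termmin_step n (\<delta>\<inverse>) Init k c cs' c'" for cs c
  proof -
    obtain \<phi> where \<phi>: "c = Return \<phi>" "Bad \<subseteq> \<phi>" "\<delta>\<inverse> `` \<phi> \<subseteq> \<phi>" "\<phi> \<subseteq> states n - I"
      using stuck_returns[OF ex[unfolded dual_exec_def]] by blast
    \<comment> \<open>Complementing turns closure under \<open>\<delta>\<inverse>\<close> back into
      closure under \<open>\<delta>\<close>; \<open>Init\<close> is kept because
      \<open>\<phi>\<close> avoids \<open>I\<close>.\<close>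
    have "inductive_invariant n Init \<delta> Bad (states n - \<phi>)"
      using \<phi>(2-4) ts inv by (auto simp: inductive_invariant_def transition_system_def)
    then show ?thesis using \<phi>(1) by blast
  qed
  then have "dual_converges n Init \<delta> Bad k"
    unfolding dual_converges_def using terminates by blast
  moreover have "count_list cs Inductiveness_Check \<le> 4 * m \<and>
      count_list cs BMC_Check \<le> 4 * (m * n) \<and> length cs \<le> 4 * (m * n)"
    if ex: "dual_exec n Init \<delta> Bad k cs c" for cs c
  proof -
    note checks = exec_checks[OF ex[unfolded dual_exec_def]]
    have a: "count_list cs Inductiveness_Check \<le> m + 1"
      using checks(1) T by linarith
    have "count_list cs BMC_Check \<le> m * (n + 1)"
      using checks(2) mult_le_mono1[OF T, of "n + 1"] by (rule le_trans)
    then have b: "count_list cs BMC_Check \<le> m * n + m" by simp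
    \<comment> \<open>The total is at most \<open>m * n + 2 * m + 1\<close>, hence the constant 4 by
      \<open>1 \<le> m\<close> and \<open>m \<le> m * n\<close>.\<close>
    show ?thesis using a b m mn count_list_checks[of cs] by linarith
  qed
  ultimately show "dual_converges n Init \<delta> Bad k \<and>
       (\<forall>cs c. dual_exec n Init \<delta> Bad k cs c \<longrightarrow>
          count_list cs Inductiveness_Check \<le> 4 * m \<and>
          count_list cs BMC_Check \<le> 4 * (m * n) \<and>
          length cs \<le> 4 * (m * n))" by blast
qed

end
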